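(* Consider a probability distribution $\pi$ on $\mathbb E=\{1,\ldots,M\}$ such that $\pi(k)>0$ for all $k\in\mathbb E$, and put $H(k)=\sum_{j=1}^k\pi(j)$. The Markov chain $X$ on $\mathbb E$ with transition matrix $$\mathbf P_0(k,r)=\begin{cases} \dfrac{\pi(r)}{\pi(1)+\pi(2)} & \text{for } k=1,\ r\in\{1,2\},\\[2mm] \dfrac{\pi(r)}{\pi(k)}\left[\dfrac{H(k)}{H(k+1)}-\dfrac{H(k-1)}{H(k)}\right] & \text{for } 1<k<M,\ r\le k,\\[2mm] \dfrac{\pi(k+1)}{\pi(k)}\dfrac{H(k)}{H(k+1)} & \text{for } 1<k<M,\ r=k+1,\\[2mm] \pi(r) & \text{for } r\le k=M, \end{cases}$$ (all other entries being $0$) is ergodic with the stationary distribution $\pi$. Assume the initial distribution is $\nu=\delta_1$ (i.e. $P(X_0=1)=1$). Then the chain has a deterministic fastest strong stationary time $T$ such that $P(T=M-1)=1$.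
   Context: Ergodic means irreducible and aperiodic. For a chain with initial distribution $\nu$, transition matrix $\mathbf P$ and stationary distribution $\pi$ on $\mathbb E$, the separation is $sep(\nu\mathbf P^k,\pi)=\max_{e\in\mathbb E}\left(1-\nu\mathbf P^k(e)/\pi(e)\right)$. A strong stationary time for $X$ is a random time $T$ such that $X_T$ has distribution $\pi$ and $T$ is independent of $X_T$; it always satisfies $sep(\nu\mathbf P^k,\pi)\le P(T>k)$. The fastest strong stationary time is the stochastically smallest one, for which $sep(\nu\mathbf P^k,\pi)=P(T>k)$ for all $k\ge0$.
   Formalization: It is additionally assumed that all entries of P_0 are nonnegative (equivalently H(k)^2 ≥ H(k-1)H(k+1) for 1<k<M); without this P_0 need not be a transition matrix, e.g. for π=(0.1,0.1,0.8). *)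

theory Defs
  imports "HOL-Probability.Probability"
begin

section \<open>Finite transition matrices\<close>

text \<open>A matrix on a finite state space \<open>E\<close> is a function of two states; only its entries at
  states in \<open>E\<close> are ever looked at.\<close>

definition stochastic_matrix :: "'a set \<Rightarrow> ('a \<Rightarrow> 'a \<Rightarrow> real) \<Rightarrow> bool" where
  "stochastic_matrix E P \<longleftrightarrow>
     (\<forall>i\<in>E. (\<forall>j\<in>E. 0 \<le> P i j) \<and> (\<Sum>j\<in>E. P i j) = 1)"

primrec matrix_pow :: "'a set \<Rightarrow> ('a \<Rightarrow> 'a \<Rightarrow> real) \<Rightarrow> nat \<Rightarrow> 'a \<Rightarrow> 'a \<Rightarrow> real" where
  "matrix_pow E P 0 i j = (if i = j then 1 else 0)"
| "matrix_pow E P (Suc n) i j = (\<Sum>l\<in>E. matrix_pow E P n i l * P l j)"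

definition irreducible_matrix :: "'a set \<Rightarrow> ('a \<Rightarrow> 'a \<Rightarrow> real) \<Rightarrow> bool" where
  "irreducible_matrix E P \<longleftrightarrow> (\<forall>i\<in>E. \<forall>j\<in>E. \<exists>n. matrix_pow E P n i j > 0)"

definition aperiodic_matrix :: "'a set \<Rightarrow> ('a \<Rightarrow> 'a \<Rightarrow> real) \<Rightarrow> bool" where
  "aperiodic_matrix E P \<longleftrightarrow> (\<forall>i\<in>E. Gcd {n. 0 < n \<and> matrix_pow E P n i i > 0} = 1)"

definition ergodic_matrix :: "'a set \<Rightarrow> ('a \<Rightarrow> 'a \<Rightarrow> real) \<Rightarrow> bool" where
  "ergodic_matrix E P \<longleftrightarrow> irreducible_matrix E P \<and> aperiodic_matrix E P"

definition stationary_distribution ::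
    "'a set \<Rightarrow> ('a \<Rightarrow> 'a \<Rightarrow> real) \<Rightarrow> ('a \<Rightarrow> real) \<Rightarrow> bool" where
  "stationary_distribution E P p \<longleftrightarrow>
     (\<forall>i\<in>E. 0 \<le> p i) \<and> (\<Sum>i\<in>E. p i) = 1 \<and>
     (\<forall>j\<in>E. (\<Sum>i\<in>E. p i * P i j) = p j)"

definition law_at :: "'a set \<Rightarrow> ('a \<Rightarrow> real) \<Rightarrow> ('a \<Rightarrow> 'a \<Rightarrow> real) \<Rightarrow> nat \<Rightarrow> 'a \<Rightarrow> real" where
  "law_at E \<nu> P k e = (\<Sum>i\<in>E. \<nu> i * matrix_pow E P k i e)"

definition separation :: "'a set \<Rightarrow> ('a \<Rightarrow> real) \<Rightarrow> ('a \<Rightarrow> real) \<Rightarrow> real" where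
  "separation E \<mu> p = (MAX e\<in>E. 1 - \<mu> e / p e)"

section \<open>Markov chains and strong stationary times\<close>

definition markov_chain ::
    "'w measure \<Rightarrow> 'a set \<Rightarrow> ('a \<Rightarrow> real) \<Rightarrow> ('a \<Rightarrow> 'a \<Rightarrow> real) \<Rightarrow> (nat \<Rightarrow> 'w \<Rightarrow> 'a) \<Rightarrow> bool" where
  "markov_chain N E \<nu> P X \<longleftrightarrow>
     prob_space N \<and>
     (\<forall>n. X n \<in> measurable N (count_space E)) \<and>
     (\<forall>i\<in>E. \<P>(\<omega> in N. X 0 \<omega> = i) = \<nu> i) \<and>
     (\<forall>n x. \<forall>j\<in>E. \<P>(\<omega> in N. \<forall>m\<le>n. X m \<omega> = x m) > 0 \<longrightarrow>
        \<P>(\<omega> in N. X (Suc n) \<omega> = j \<bar> \<forall>m\<le>n. X m \<omega> = x m) = P (x n) j)"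

text \<open>A strong stationary time is here any random time \<open>T\<close> (not necessarily a stopping time) such
  that \<open>X\<^sub>T\<close> has law \<open>p\<close> and is independent of \<open>T\<close>. Being fastest is therefore minimality in a class
  containing all randomized stopping times with these properties. As \<open>X\<^sub>T\<close> has a probability law,
  \<open>T\<close> is almost surely finite, so natural numbers suffice as values.
  Independence is that of the generated \<open>\<sigma>\<close>-algebras because \<open>indep_var\<close> needs equal value types.\<close>

definition strong_stationary_time ::
    "'w measure \<Rightarrow> 'a set \<Rightarrow> ('a \<Rightarrow> real) \<Rightarrow> (nat \<Rightarrow> 'w \<Rightarrow> 'a) \<Rightarrow> ('w \<Rightarrow> nat) \<Rightarrow> bool" where
  "strong_stationary_time N E p X T \<longleftrightarrow>
     T \<in> measurable N (count_space UNIV) \<and>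
     (\<forall>e\<in>E. \<P>(\<omega> in N. X (T \<omega>) \<omega> = e) = p e) \<and>
     prob_space.indep_set N
       (sets (vimage_algebra (space N) T (count_space UNIV)))
       (sets (vimage_algebra (space N) (\<lambda>\<omega>. X (T \<omega>) \<omega>) (count_space E)))"

definition fastest_strong_stationary_time ::
    "'w measure \<Rightarrow> 'a set \<Rightarrow> ('a \<Rightarrow> real) \<Rightarrow> ('a \<Rightarrow> 'a \<Rightarrow> real) \<Rightarrow> ('a \<Rightarrow> real) \<Rightarrow>
      (nat \<Rightarrow> 'w \<Rightarrow> 'a) \<Rightarrow> ('w \<Rightarrow> nat) \<Rightarrow> bool" where
  "fastest_strong_stationary_time N E \<nu> P p X T \<longleftrightarrow>
     strong_stationary_time N E p X T \<and>
     (\<forall>T'. strong_stationary_time N E p X T' \<longrightarrow>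
        (\<forall>k. \<P>(\<omega> in N. T \<omega> > k) \<le> \<P>(\<omega> in N. T' \<omega> > k))) \<and>
     (\<forall>k. separation E (law_at E \<nu> P k) p = \<P>(\<omega> in N. T \<omega> > k))"

section \<open>The matrix \<open>P\<^sub>0\<close>\<close>

definition cumulative :: "(nat \<Rightarrow> real) \<Rightarrow> nat \<Rightarrow> real" where
  "cumulative p k = (\<Sum>j=1..k. p j)"

definition P0 :: "nat \<Rightarrow> (nat \<Rightarrow> real) \<Rightarrow> nat \<Rightarrow> nat \<Rightarrow> real" where
  "P0 M p k r =
     (let H = cumulative p in
      if k = 1 \<and> r \<in> {1, 2} then p r / (p 1 + p 2)
      else if 1 < k \<and> k < M \<and> r \<in> {1..k} then
        p r / p k * (H k / H (k + 1) - H (k - 1) / H k)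
      else if 1 < k \<and> k < M \<and> r = k + 1 then
        p (k + 1) / p k * (H k / H (k + 1))
      else if 1 < k \<and> k = M \<and> r \<in> {1..k} then p r
      else 0)"

end

theory Submission
  imports Defs
begin

text \<open>Write \<open>H k\<close> for the cumulative sums of \<open>\<pi>\<close>. The matrix is built so that, started at \<open>1\<close>, the
  chain has law \<open>\<pi>\<close> conditioned on \<open>{1..n + 1}\<close> at each time \<open>n < M\<close>. The reason is a telescoping
  sum: starting from the unnormalized measure \<open>\<pi>\<close> restricted to \<open>{1..m}\<close>, one step produces
  \<open>H m / H (m + 1)\<close> times \<open>\<pi>\<close> restricted to \<open>{1..m + 1}\<close> (\<open>P0_sum_below\<close>). Taking \<open>m = M\<close> in this
  identity gives stationarity of \<open>\<pi>\<close>, and dividing by \<open>H m\<close> gives the law of the chain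
  (\<open>P0_law\<close>).

  Hence state \<open>M\<close> has probability zero before time \<open>M - 1\<close>, and the law is exactly \<open>\<pi>\<close> from then
  on. The separation therefore drops from \<open>1\<close> to \<open>0\<close> at time \<open>M - 1\<close>, and the constant time \<open>M - 1\<close>
  is strong stationary, a constant being independent of everything. No strong stationary time can
  take a value \<open>n < M - 1\<close> with positive probability: by independence the chain would then be in
  \<open>M\<close> at time \<open>n\<close> with positive probability (\<open>strong_stationary_time_avoids\<close>). So the constant time
  is the stochastically smallest one.

  For ergodicity, every state climbs to \<open>M\<close> one level at a time, and from \<open>M\<close> all states, including
  \<open>M\<close> itself, are reached in one step. The nonnegativity of the entries, which amounts to
  log-concavity of \<open>H\<close>, ensures that such path probabilities cannot cancel.\<close>

section \<open>Irreducibility and aperiodicity of finite nonnegative matrices\<close>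

lemma matrix_pow_nonneg:
  assumes "\<forall>i\<in>E. \<forall>j\<in>E. 0 \<le> P i j" "j \<in> E"
  shows "0 \<le> matrix_pow E P n i j"
  using assms(2) by (induction n arbitrary: j) (auto intro!: sum_nonneg simp: assms(1))

text \<open>All terms of the sum over intermediate states are nonnegative, so one positive path suffices.\<close>

lemma matrix_pow_Suc_pos:
  assumes "finite E" "\<forall>i\<in>E. \<forall>j\<in>E. 0 \<le> P i j" "l \<in> E" "j \<in> E"
    and "0 < matrix_pow E P n i l" "0 < P l j"
  shows "0 < matrix_pow E P (Suc n) i j"
proof -
  have "0 < matrix_pow E P n i l * P l j"
    using assms by simp
  also have "\<dots> \<le> matrix_pow E P (Suc n) i j"
    unfolding matrix_pow.simps using assms
    by (intro member_le_sum) (auto intro: matrix_pow_nonneg mult_nonneg_nonneg)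
  finally show ?thesis .
qed

lemma matrix_pow_add_pos:
  assumes "finite E" "\<forall>i\<in>E. \<forall>j\<in>E. 0 \<le> P i j" "l \<in> E" "j \<in> E"
    and "0 < matrix_pow E P m i l" "0 < matrix_pow E P n l j"
  shows "0 < matrix_pow E P (m + n) i j"
  using assms(4,6)
proof (induction n arbitrary: j)
  case 0
  then show ?case using assms(5) by (simp split: if_splits)
next
  case (Suc n)
  have "\<exists>q\<in>E. 0 < matrix_pow E P n l q * P q j"
  proof (rule ccontr)
    assume "\<not> ?thesis"
    then have "matrix_pow E P (Suc n) l j \<le> 0"
      unfolding matrix_pow.simps by (intro sum_nonpos) (simp add: not_less)
    then show False using Suc.prems(2) by linarith
  qed
  then obtain q where q: "q \<in> E" "0 < matrix_pow E P n l q * P q j" by blast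
  then have "0 < matrix_pow E P n l q" "0 < P q j"
    using matrix_pow_nonneg[OF assms(2) q(1), of n l] by (auto simp: zero_less_mult_iff)
  then show ?case
    using matrix_pow_Suc_pos[OF assms(1,2) q(1) Suc.prems(1)] Suc.IH[OF q(1)] by simp
qed

text \<open>A loop at \<open>i\<close> through \<open>a\<close> can be prolonged by one step at \<open>a\<close>, so two consecutive numbers are
  return times of \<open>i\<close>.\<close>

lemma irreducible_self_loop_aperiodic:
  assumes "finite E" "\<forall>i\<in>E. \<forall>j\<in>E. 0 \<le> P i j" "irreducible_matrix E P"
    and "a \<in> E" "0 < P a a"
  shows "aperiodic_matrix E P"
  unfolding aperiodic_matrix_def
proof
  fix i assume i: "i \<in> E"
  let ?S = "{n. 0 < n \<and> matrix_pow E P n i i > 0}"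
  obtain m n where m: "0 < matrix_pow E P m i a" and n: "0 < matrix_pow E P n a i"
    using assms(3,4) i unfolding irreducible_matrix_def by blast
  \<comment> \<open>One self-loop step is spent in both paths because the loop of length \<open>m + n\<close> may be empty.\<close>
  have m1: "0 < matrix_pow E P (Suc m) i a"
    using matrix_pow_Suc_pos[OF assms(1,2,4,4) m assms(5)] .
  have m2: "0 < matrix_pow E P (Suc (Suc m)) i a"
    using matrix_pow_Suc_pos[OF assms(1,2,4,4) m1 assms(5)] .
  have "Suc m + n \<in> ?S" "Suc (Suc m) + n \<in> ?S"
    using matrix_pow_add_pos[OF assms(1,2,4) i m1 n] matrix_pow_add_pos[OF assms(1,2,4) i m2 n]
    by simp_all
  then have "Gcd ?S dvd Suc m + n" "Gcd ?S dvd Suc (Suc m + n)"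
    by (auto intro: Gcd_dvd)
  then have "Gcd ?S dvd 1"
    by (metis Suc_eq_plus1 dvd_add_right_iff)
  then show "Gcd ?S = 1" by simp
qed

section \<open>Laws of Markov chains and separation\<close>

lemma law_at_Suc:
  "law_at E \<nu> P (Suc k) e = (\<Sum>l\<in>E. law_at E \<nu> P k l * P l e)"
  unfolding law_at_def matrix_pow.simps sum_distrib_left sum_distrib_right
  by (subst sum.swap) (simp add: mult.assoc)

text \<open>The Markov property is given conditionally on entire past paths; since \<open>E\<close> is finite, summing over
  the finitely many paths that end in \<open>i\<close> yields the transition probability given the present
  state only.\<close>

lemma markov_chain_transition:
  assumes "finite E" "markov_chain N E \<nu> P X" "i \<in> E" "j \<in> E"
  shows "\<P>(\<omega> in N. X n \<omega> = i \<and> X (Suc n) \<omega> = j) = \<P>(\<omega> in N. X n \<omega> = i) * P i j"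
proof -
  interpret prob_space N using assms(2) by (simp add: markov_chain_def)
  have X[measurable]: "X m \<in> measurable N (count_space E)" for m
    using assms(2) by (simp add: markov_chain_def)
  have XE: "X m \<omega> \<in> E" if "\<omega> \<in> space N" for m \<omega>
    using measurable_space[OF X that] by simp
  have sX: "{\<omega> \<in> space N. X m \<omega> = c} \<in> sets N" for m c
    by measurable
  define paths where "paths = {x \<in> {..n} \<rightarrow>\<^sub>E E. x n = i}"
  have fin: "finite paths"
    unfolding paths_def using assms(1) by (auto intro!: finite_PiE)
  define A where "A x = {\<omega> \<in> space N. \<forall>m\<le>n. X m \<omega> = x m}" for x
  define B where "B = {\<omega> \<in> space N. X (Suc n) \<omega> = j}"
  have A: "A x \<in> sets N" for x
    unfolding A_def using sets.sets_Collect_finite_All'[of "{..n}" N "\<lambda>m \<omega>. X m \<omega> = x m"] sX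
    by simp
  have B: "B \<in> sets N" unfolding B_def by (rule sX)
  have disj: "disjoint_family_on A paths"
    unfolding disjoint_family_on_def A_def paths_def
    by (auto intro!: PiE_ext)
  \<comment> \<open>Nothing is known about conditioning on a null path, but then both sides vanish.\<close>
  have AB: "measure N (A x \<inter> B) = measure N (A x) * P i j" if "x \<in> paths" for x
  proof (cases "measure N (A x) > 0")
    case True
    have "\<P>(\<omega> in N. X (Suc n) \<omega> = j \<bar> \<forall>m\<le>n. X m \<omega> = x m) = P i j"
      using assms(2,4) True that unfolding markov_chain_def A_def paths_def by auto
    moreover have "{\<omega> \<in> space N. X (Suc n) \<omega> = j \<and> (\<forall>m\<le>n. X m \<omega> = x m)} = A x \<inter> B"
      unfolding A_def B_def by auto
    ultimately show ?thesis
      using True unfolding cond_prob_def A_def[symmetric] by (simp add: field_simps)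
  next
    case False
    then have z: "measure N (A x) = 0" using measure_nonneg[of N "A x"] by linarith
    moreover have "measure N (A x \<inter> B) \<le> measure N (A x)"
      using A by (intro finite_measure_mono) auto
    ultimately show ?thesis using measure_nonneg[of N "A x \<inter> B"] by simp
  qed
  have U: "{\<omega> \<in> space N. X n \<omega> = i} = (\<Union>x\<in>paths. A x)"
  proof safe
    fix \<omega> assume w: "\<omega> \<in> space N" "i = X n \<omega>"
    have "(\<lambda>m\<in>{..n}. X m \<omega>) \<in> paths" "\<omega> \<in> A (\<lambda>m\<in>{..n}. X m \<omega>)"
      using w XE by (auto simp: paths_def A_def)
    then show "\<omega> \<in> (\<Union>x\<in>paths. A x)" by blast
  qed (auto simp: A_def paths_def)
  have "{\<omega> \<in> space N. X n \<omega> = i \<and> X (Suc n) \<omega> = j} = (\<Union>x\<in>paths. A x) \<inter> B"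
    unfolding U[symmetric] B_def by auto
  also have "\<dots> = (\<Union>x\<in>paths. A x \<inter> B)" by auto
  finally have "\<P>(\<omega> in N. X n \<omega> = i \<and> X (Suc n) \<omega> = j) = measure N (\<Union>x\<in>paths. A x \<inter> B)"
    by simp
  also have "\<dots> = (\<Sum>x\<in>paths. measure N (A x \<inter> B))"
    using fin A B disj
    by (intro finite_measure_finite_Union) (auto simp: disjoint_family_on_def)
  also have "\<dots> = (\<Sum>x\<in>paths. measure N (A x)) * P i j"
    by (simp add: AB sum_distrib_right)
  also have "(\<Sum>x\<in>paths. measure N (A x)) = \<P>(\<omega> in N. X n \<omega> = i)"
    unfolding U using fin A disj by (subst finite_measure_finite_Union) auto
  finally show ?thesis .
qed

lemma markov_chain_law:
  assumes "finite E" "markov_chain N E \<nu> P X" "e \<in> E"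
  shows "\<P>(\<omega> in N. X n \<omega> = e) = law_at E \<nu> P n e"
  using assms(3)
proof (induction n arbitrary: e)
  case 0
  have "law_at E \<nu> P 0 e = (\<Sum>i\<in>E. if i = e then \<nu> i else 0)"
    unfolding law_at_def by (intro sum.cong) auto
  then show ?case
    using 0 assms(1,2) by (simp add: markov_chain_def)
next
  case (Suc n)
  interpret prob_space N using assms(2) by (simp add: markov_chain_def)
  have X[measurable]: "X m \<in> measurable N (count_space E)" for m
    using assms(2) by (simp add: markov_chain_def)
  have XE: "X m \<omega> \<in> E" if "\<omega> \<in> space N" for m \<omega>
    using measurable_space[OF X that] by simp
  have "{\<omega> \<in> space N. X (Suc n) \<omega> = e}
      = (\<Union>i\<in>E. {\<omega> \<in> space N. X n \<omega> = i \<and> X (Suc n) \<omega> = e})"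
    using XE by auto
  then have "\<P>(\<omega> in N. X (Suc n) \<omega> = e)
      = (\<Sum>i\<in>E. \<P>(\<omega> in N. X n \<omega> = i \<and> X (Suc n) \<omega> = e))"
    using assms(1)
    by (simp, subst finite_measure_finite_Union) (auto simp: disjoint_family_on_def)
  also have "\<dots> = (\<Sum>i\<in>E. law_at E \<nu> P n i * P i e)"
    using Suc by (intro sum.cong) (simp_all add: markov_chain_transition[OF assms(1,2)])
  finally show ?case by (simp add: law_at_Suc)
qed

lemma separation_eq_1:
  assumes "finite E" "a \<in> E" "\<mu> a = 0" "\<forall>e\<in>E. 0 \<le> \<mu> e" "\<forall>e\<in>E. 0 \<le> p e"
  shows "separation E \<mu> p = 1"
  unfolding separation_def using assms
  by (intro Max_eqI) (auto simp: image_iff intro!: bexI[of _ a])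

lemma separation_self:
  assumes "finite E" "E \<noteq> {}" "\<forall>e\<in>E. \<mu> e = p e" "\<forall>e\<in>E. p e \<noteq> 0"
  shows "separation E \<mu> p = 0"
proof -
  have "(\<lambda>e. 1 - \<mu> e / p e) ` E = {0}" using assms by auto
  then show ?thesis by (simp add: separation_def)
qed

section \<open>Strong stationary times\<close>

lemma strong_stationary_time_const:
  assumes "markov_chain N E \<nu> P X" "\<forall>e\<in>E. \<P>(\<omega> in N. X c \<omega> = e) = p e"
  shows "strong_stationary_time N E p X (\<lambda>_. c)"
proof -
  interpret prob_space N using assms(1) by (simp add: markov_chain_def)
  have X[measurable]: "X m \<in> measurable N (count_space E)" for m
    using assms(1) by (simp add: markov_chain_def)
  let ?F = "sets (vimage_algebra (space N) (\<lambda>_. c) (count_space UNIV))"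
  let ?G = "sets (vimage_algebra (space N) (X c) (count_space E))"
  have F: "?F \<subseteq> {{}, space N}"
    by (auto simp: sets_vimage_algebra2)
  have G: "?G \<subseteq> events"
    using measurable_space[OF X]
    by (subst sets_vimage_algebra2) (auto intro: measurable_sets[OF X])
  have "indep_set ?F ?G"
    unfolding indep_sets2_eq
  proof (intro conjI ballI)
    show "?F \<subseteq> events" using F by auto
    show "?G \<subseteq> events" by (rule G)
    fix a b assume "a \<in> ?F" "b \<in> ?G"
    then have "a = {} \<or> a = space N" "b \<in> events" using F G by auto
    then show "prob (a \<inter> b) = prob a * prob b"
      by (auto simp: prob_space)
  qed
  then show ?thesis
    using assms(2) by (simp add: strong_stationary_time_def)
qed

text \<open>On the event \<open>T = n\<close> the state \<open>X\<^sub>T\<close> is \<open>X\<^sub>n\<close>, so by independence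
  \<open>P(T = n) p(e) = P(T = n, X\<^sub>n = e) = 0\<close>, and \<open>p(e)\<close> can be cancelled.\<close>

lemma strong_stationary_time_avoids:
  assumes "markov_chain N E \<nu> P X" "strong_stationary_time N E p X T"
    and "e \<in> E" "p e \<noteq> 0" "\<P>(\<omega> in N. X n \<omega> = e) = 0"
  shows "\<P>(\<omega> in N. T \<omega> = n) = 0"
proof -
  interpret prob_space N using assms(1) by (simp add: markov_chain_def)
  have X[measurable]: "X m \<in> measurable N (count_space E)" for m
    using assms(1) by (simp add: markov_chain_def)
  let ?Y = "\<lambda>\<omega>. X (T \<omega>) \<omega>"
  have YE: "?Y \<in> space N \<rightarrow> E"
    using measurable_space[OF X] by auto
  have ind: "indep_set (sets (vimage_algebra (space N) T (count_space UNIV)))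
       (sets (vimage_algebra (space N) ?Y (count_space E)))"
    using assms(2) by (simp add: strong_stationary_time_def)
  have "T -` {n} \<inter> space N \<in> sets (vimage_algebra (space N) T (count_space UNIV))"
    by (rule in_vimage_algebra) simp
  moreover have "?Y -` {e} \<inter> space N \<in> sets (vimage_algebra (space N) ?Y (count_space E))"
    using assms(3) by (intro in_vimage_algebra) simp
  ultimately have "prob ((T -` {n} \<inter> space N) \<inter> (?Y -` {e} \<inter> space N))
      = prob (T -` {n} \<inter> space N) * prob (?Y -` {e} \<inter> space N)"
    by (rule indep_setD[OF ind])
  moreover have "?Y -` {e} \<inter> space N = {\<omega> \<in> space N. ?Y \<omega> = e}" by auto
  moreover have "prob {\<omega> \<in> space N. ?Y \<omega> = e} = p e"
    using assms(2,3) by (simp add: strong_stationary_time_def)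
  moreover have "prob ((T -` {n} \<inter> space N) \<inter> (?Y -` {e} \<inter> space N))
      \<le> prob {\<omega> \<in> space N. X n \<omega> = e}"
    by (intro finite_measure_mono) auto
  moreover have "T -` {n} \<inter> space N = {\<omega> \<in> space N. T \<omega> = n}" by auto
  ultimately show ?thesis
    using assms(4,5) measure_nonneg[of N "(T -` {n} \<inter> space N) \<inter> (?Y -` {e} \<inter> space N)"] by simp
qed

lemma strong_stationary_time_ge:
  assumes "markov_chain N E \<nu> P X" "strong_stationary_time N E p X T"
    and "e \<in> E" "p e \<noteq> 0" "\<forall>n\<le>k. \<P>(\<omega> in N. X n \<omega> = e) = 0"
  shows "\<P>(\<omega> in N. T \<omega> > k) = 1"
proof -
  interpret prob_space N using assms(1) by (simp add: markov_chain_def)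
  have T: "T \<in> measurable N (count_space UNIV)"
    using assms(2) by (simp add: strong_stationary_time_def)
  have s: "{\<omega> \<in> space N. T \<omega> = n} \<in> events" for n
    using T by measurable
  have "AE \<omega> in N. \<forall>n\<in>{..k}. T \<omega> \<noteq> n"
  proof (rule AE_finite_allI)
    fix n assume "n \<in> {..k}"
    then have "prob {\<omega> \<in> space N. T \<omega> = n} = 0"
      using strong_stationary_time_avoids[OF assms(1-4)] assms(5) by simp
    then show "AE \<omega> in N. T \<omega> \<noteq> n"
      using s[of n] by (subst AE_iff_measurable[where N="{\<omega> \<in> space N. T \<omega> = n}"])
        (auto simp: emeasure_eq_measure)
  qed simp
  then have "AE \<omega> in N. T \<omega> > k"
    by (rule AE_mp) (rule AE_I2, auto simp: not_le[symmetric])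
  then show ?thesis
    using T by (subst prob_Collect_eq_1) auto
qed

section \<open>The matrix \<open>P\<^sub>0\<close>\<close>

text \<open>Extending \<open>p\<close> by zero beyond \<open>M\<close> makes \<open>H (Suc M) = 1\<close> available, which lets the last row of
  \<open>P\<^sub>0\<close> be treated like the others.\<close>

locale positive_distribution =
  fixes M :: nat and p :: "nat \<Rightarrow> real"
  assumes M_pos: "1 \<le> M"
    and p_pos: "\<And>k. k \<in> {1..M} \<Longrightarrow> 0 < p k"
    and p_beyond: "\<And>k. M < k \<Longrightarrow> p k = 0"
    and p_sum: "(\<Sum>k=1..M. p k) = 1"
begin

abbreviation "H \<equiv> cumulative p"
abbreviation "E \<equiv> {1..M}"

lemma H_0: "H 0 = 0" by (simp add: cumulative_def)

lemma H_Suc: "H (Suc k) = H k + p (Suc k)" by (simp add: cumulative_def)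

lemma H_M: "H M = 1" using p_sum by (simp add: cumulative_def)

lemma H_beyond: "M \<le> k \<Longrightarrow> H k = 1"
  by (induction k rule: dec_induct) (simp_all add: H_M H_Suc p_beyond)

lemma p_nonneg: "1 \<le> k \<Longrightarrow> 0 \<le> p k"
  using p_pos[of k] p_beyond[of k] by (cases "k \<le> M") auto

lemma H_pos: "1 \<le> k \<Longrightarrow> 0 < H k"
proof (induction k rule: dec_induct)
  case base
  then show ?case using p_pos[of 1] M_pos by (simp add: H_Suc H_0)
next
  case (step k)
  then show ?case using p_nonneg[of "Suc k"] by (simp add: H_Suc)
qed

text \<open>The case distinction in the definition is only apparent. At \<open>k = 1\<close> the general formula
  applies because \<open>H 0 = 0\<close>, and at \<open>k = M\<close> it applies because \<open>p\<close> vanishes beyond \<open>M\<close>, so that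
  \<open>H (M + 1) = 1\<close>. Thus two formulas cover every row.\<close>

lemma P0_down:
  assumes "1 \<le> r" "r \<le> k" "k \<le> M"
  shows "P0 M p k r = p r / p k * (H k / H (Suc k) - H (k - 1) / H k)"
proof -
  consider "k = 1" | "1 < k" "k < M" | "k = M" "1 < M" using assms by linarith
  then show ?thesis
  proof cases
    case 1
    then show ?thesis
      using assms p_pos[of 1] M_pos by (simp add: P0_def Let_def H_Suc H_0 numeral_2_eq_2)
  next
    case 2
    then show ?thesis
      using assms by (simp add: P0_def Let_def)
  next
    case k: 3
    then have "1 - H (M - 1) = p M"
      using H_Suc[of "M - 1"] H_M by simp
    then show ?thesis
      using assms k p_pos[of M] H_beyond[of "Suc M"] H_M by (auto simp: P0_def Let_def)
  qed
qed

lemma P0_up: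
  assumes "1 \<le> k" "k \<le> M"
  shows "P0 M p k (Suc k) = p (Suc k) / p k * (H k / H (Suc k))"
proof -
  consider "k = 1" | "1 < k" "k < M" | "k = M" "1 < M" using assms by linarith
  then show ?thesis
  proof cases
    case 1
    then show ?thesis
      using p_pos[of 1] M_pos by (simp add: P0_def Let_def H_Suc H_0 numeral_2_eq_2)
  next
    case 2
    then show ?thesis by (simp add: P0_def Let_def)
  next
    case 3
    then show ?thesis using p_beyond[of "Suc M"] by (auto simp: P0_def Let_def)
  qed
qed

lemma P0_far: "Suc k < r \<Longrightarrow> P0 M p k r = 0"
  by (auto simp: P0_def Let_def)

text \<open>The row \<open>k\<close> contributes \<open>p r * (H k / H (k + 1) - H (k - 1) / H k)\<close> to each column \<open>r \<le> k\<close>, so the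
  contributions telescope; the entry above the diagonal provides exactly the missing initial
  term of the column \<open>r = k + 1\<close>. The empty sum \<open>m = 0\<close> is consistent with the formula
  because \<open>H 0 = 0\<close>.\<close>

lemma P0_sum_below:
  assumes "m \<le> M" "1 \<le> r"
  shows "(\<Sum>k=1..m. p k * P0 M p k r) = (if r \<le> Suc m then p r * (H m / H (Suc m)) else 0)"
  using assms(1)
proof (induction m)
  case 0
  then show ?case by (simp add: H_0)
next
  case (Suc m)
  have pm: "p (Suc m) \<noteq> 0" using p_pos[of "Suc m"] Suc.prems by simp
  have "(\<Sum>k=1..Suc m. p k * P0 M p k r)
      = (if r \<le> Suc m then p r * (H m / H (Suc m)) else 0) + p (Suc m) * P0 M p (Suc m) r"
    using Suc by simp
  also have "\<dots> = (if r \<le> Suc (Suc m) then p r * (H (Suc m) / H (Suc (Suc m))) else 0)"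
  proof -
    consider "r \<le> Suc m" | "r = Suc (Suc m)" | "r > Suc (Suc m)" by linarith
    then show ?thesis
    proof cases
      case 1
      then show ?thesis
        by (subst P0_down) (use assms(2) Suc.prems pm in \<open>auto simp: right_diff_distrib\<close>)
    next
      case 2
      then show ?thesis using P0_up[of "Suc m"] Suc.prems pm by simp
    next
      case 3
      then show ?thesis using P0_far by simp
    qed
  qed
  finally show ?case .
qed

lemma P0_stationary:
  assumes "1 \<le> r"
  shows "(\<Sum>k\<in>E. p k * P0 M p k r) = p r"
  using P0_sum_below[OF order_refl assms] H_beyond[of M] H_beyond[of "Suc M"] p_beyond[of r]
  by simp

lemma P0_row_sum:
  assumes "k \<in> E"
  shows "(\<Sum>r\<in>E. P0 M p k r) = 1"
proof -
  have pk: "p k \<noteq> 0" and Hk: "H k \<noteq> 0" "H (Suc k) \<noteq> 0"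
    using p_pos[OF assms] H_pos[of k] H_pos[of "Suc k"] assms by auto
  \<comment> \<open>For \<open>k = M\<close> the added entry \<open>r = M + 1\<close> is zero, so the last row needs no separate computation.\<close>
  have "(\<Sum>r\<in>E. P0 M p k r) = (\<Sum>r=1..Suc k. P0 M p k r)"
  proof (cases "k = M")
    case True
    then show ?thesis using P0_up[of k] assms p_beyond[of "Suc M"] by simp
  next
    case False
    then show ?thesis
      using assms by (intro sum.mono_neutral_right) (auto intro: P0_far)
  qed
  also have "\<dots> = (\<Sum>r=1..k. p r * ((H k / H (Suc k) - H (k - 1) / H k) / p k))
      + p (Suc k) / p k * (H k / H (Suc k))"
    using assms by (simp add: P0_down P0_up)
  also have "(\<Sum>r=1..k. p r * ((H k / H (Suc k) - H (k - 1) / H k) / p k))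
      = H k * ((H k / H (Suc k) - H (k - 1) / H k) / p k)"
    unfolding sum_distrib_right[symmetric] cumulative_def[of p k] ..
  also have "H (k - 1) = H k - p k"
    using H_Suc[of "k - 1"] assms by simp
  also have "H k * ((H k / H (Suc k) - (H k - p k) / H k) / p k)
      + p (Suc k) / p k * (H k / H (Suc k)) = (H k * ((H k + p (Suc k)) / H (Suc k)) - (H k - p k)) / p k"
    using pk Hk by (simp add: field_simps)
  also have "\<dots> = 1"
    using pk Hk by (simp add: H_Suc[symmetric])
  finally show ?thesis .
qed

text \<open>The law is \<open>p\<close> conditioned on \<open>{1..n + 1}\<close>: dividing \<open>P0_sum_below\<close> by \<open>H m\<close> shows that one step
  turns \<open>p\<close> conditioned on \<open>{1..m}\<close> into \<open>p\<close> conditioned on \<open>{1..m + 1}\<close>. For \<open>n + 1 \<ge> M\<close> the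
  formula gives \<open>p\<close> itself, as \<open>H\<close> is then constantly \<open>1\<close>.\<close>

lemma P0_law:
  assumes "e \<in> E"
  shows "law_at E (pmf (return_pmf 1)) (P0 M p) n e
    = (if e \<le> Suc n then p e / H (Suc n) else 0)"
  using assms
proof (induction n arbitrary: e)
  case 0
  have "law_at E (pmf (return_pmf 1)) (P0 M p) 0 e = (\<Sum>i\<in>E. if i = e then pmf (return_pmf 1) i else 0)"
    unfolding law_at_def by (intro sum.cong) auto
  also have "\<dots> = (if e = 1 then 1 else 0)"
    using 0 by (simp add: indicator_def)
  finally show ?case
    using 0 p_pos[of 1] by (cases "e = 1") (simp_all add: H_Suc H_0 del: pmf_return)
next
  case (Suc n)
  have e: "1 \<le> e" "e \<le> M" using Suc.prems by auto
  \<comment> \<open>Capping at \<open>M\<close> treats the growing phase and the stationary phase together.\<close>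
  define m where "m = min (Suc n) M"
  have m: "m \<le> M" "1 \<le> m" "H m = H (Suc n)" "H (Suc m) = H (Suc (Suc n))"
    using M_pos H_beyond by (auto simp: m_def min_def)
  have "law_at E (pmf (return_pmf 1)) (P0 M p) (Suc n) e
      = (\<Sum>l\<in>E. (if l \<le> Suc n then p l / H (Suc n) else 0) * P0 M p l e)"
    unfolding law_at_Suc by (intro sum.cong) (simp_all only: Suc.IH)
  also have "\<dots> = (\<Sum>l\<in>{1..m}. p l * P0 M p l e / H m)"
    unfolding m(3) by (intro sum.mono_neutral_cong_right) (auto simp: m_def)
  also have "\<dots> = (if e \<le> Suc m then p e * (H m / H (Suc m)) else 0) / H m"
    using P0_sum_below[OF m(1) e(1)] by (simp add: sum_divide_distrib[symmetric])
  also have "\<dots> = (if e \<le> Suc (Suc n) then p e / H (Suc (Suc n)) else 0)"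
    using H_pos[OF m(2)] e m by (auto simp: m_def min_def split: if_splits)
  finally show ?case .
qed

text \<open>Before time \<open>M - 1\<close> the state \<open>M\<close> has not been reached; from that time on the law is \<open>p\<close>.\<close>

lemma P0_separation:
  "separation E (law_at E (pmf (return_pmf 1)) (P0 M p) n) p = (if n < M - 1 then 1 else 0)"
proof -
  define \<mu> where "\<mu> = law_at E (pmf (return_pmf 1)) (P0 M p) n"
  have \<mu>: "\<mu> e = (if e \<le> Suc n then p e / H (Suc n) else 0)" if "e \<in> E" for e
    using P0_law[OF that] by (simp add: \<mu>_def)
  have p: "\<forall>e\<in>E. 0 \<le> p e" "\<forall>e\<in>E. p e \<noteq> 0"
    using p_pos by (force simp: less_imp_le)+
  have "separation E \<mu> p = (if n < M - 1 then 1 else 0)"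
  proof (cases "n < M - 1")
    case True
    have "\<forall>e\<in>E. 0 \<le> \<mu> e"
      using p(1) H_pos[of "Suc n"] by (simp add: \<mu>)
    moreover have "\<mu> M = 0" using True by (simp add: \<mu>)
    ultimately show ?thesis
      using True p(1) by (subst separation_eq_1[where a = M]) auto
  next
    case False
    then have "\<forall>e\<in>E. \<mu> e = p e" by (auto simp: \<mu> H_beyond)
    then show ?thesis
      using False p(2) M_pos by (subst separation_self) auto
  qed
  then show ?thesis by (simp add: \<mu>_def)
qed

lemma P0_up_pos:
  assumes "1 \<le> k" "k < M"
  shows "0 < P0 M p k (Suc k)"
  using assms P0_up[of k] p_pos[of k] p_pos[of "Suc k"] H_pos[of k] H_pos[of "Suc k"] by simp

lemma P0_last:
  assumes "r \<in> E"
  shows "P0 M p M r = p r"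
proof -
  have "H (M - 1) = 1 - p M"
    using H_Suc[of "M - 1"] M_pos H_M by simp
  then show ?thesis
    using assms P0_down[of r M] H_M H_beyond[of "Suc M"] p_pos[of M] M_pos by simp
qed

lemma P0_matrix_pow_up_pos:
  assumes "\<forall>k\<in>E. \<forall>r\<in>E. 0 \<le> P0 M p k r" "i \<in> E" "i \<le> j" "j \<le> M"
  shows "0 < matrix_pow E (P0 M p) (j - i) i j"
  using assms(3,4)
proof (induction j rule: dec_induct)
  case (step j)
  then show ?case
    using matrix_pow_Suc_pos[OF _ assms(1), of j "Suc j" "j - i" i] P0_up_pos[of j] assms(2)
    by (simp add: Suc_diff_le)
qed simp

lemma P0_irreducible:
  assumes "\<forall>k\<in>E. \<forall>r\<in>E. 0 \<le> P0 M p k r"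
  shows "irreducible_matrix E (P0 M p)"
  unfolding irreducible_matrix_def
proof (intro ballI)
  fix i j assume i: "i \<in> E" and j: "j \<in> E"
  have "0 < matrix_pow E (P0 M p) (Suc (M - i)) i j"
    using P0_matrix_pow_up_pos[OF assms i, of M] i j P0_last[OF j] p_pos[OF j] M_pos
    by (intro matrix_pow_Suc_pos[OF _ assms, of M]) auto
  then show "\<exists>n. 0 < matrix_pow E (P0 M p) n i j" by blast
qed

lemma P0_ergodic:
  assumes "\<forall>k\<in>E. \<forall>r\<in>E. 0 \<le> P0 M p k r"
  shows "ergodic_matrix E (P0 M p)"
proof -
  have "0 < P0 M p M M" using P0_last[of M] p_pos[of M] M_pos by simp
  then show ?thesis
    using irreducible_self_loop_aperiodic[OF _ assms P0_irreducible[OF assms], of M]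
      P0_irreducible[OF assms] M_pos
    by (simp add: ergodic_matrix_def)
qed

lemma P0_fastest_strong_stationary_time:
  assumes "markov_chain N E (pmf (return_pmf 1)) (P0 M p) X"
  shows "fastest_strong_stationary_time N E (pmf (return_pmf 1)) (P0 M p) p X (\<lambda>_. M - 1)"
proof -
  interpret prob_space N using assms by (simp add: markov_chain_def)
  have law: "\<P>(\<omega> in N. X n \<omega> = e) = (if e \<le> Suc n then p e / H (Suc n) else 0)"
    if "e \<in> E" for n e
    using markov_chain_law[OF _ assms that] P0_law[OF that] by simp
  have tail: "\<P>(\<omega> in N. M - 1 > k) = (if k < M - 1 then 1 else 0)" for k
    by (simp add: prob_space)
  have "strong_stationary_time N E p X (\<lambda>_. M - 1)"
    using M_pos by (intro strong_stationary_time_const[OF assms]) (auto simp: law H_beyond)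
  moreover have "\<P>(\<omega> in N. M - 1 > k) \<le> \<P>(\<omega> in N. T' \<omega> > k)"
    if "strong_stationary_time N E p X T'" for T' k
  proof (cases "k < M - 1")
    case True
    then have "\<P>(\<omega> in N. T' \<omega> > k) = 1"
      using p_pos[of M] M_pos
      by (intro strong_stationary_time_ge[OF assms that, of M]) (auto simp: law)
    then show ?thesis by simp
  qed (simp add: tail)
  ultimately show ?thesis
    unfolding fastest_strong_stationary_time_def tail P0_separation by blast
qed

end

theorem corollary4p17:
  fixes M :: nat and \<pi> :: "nat pmf"
  assumes "set_pmf \<pi> = {1..M}"
    and "\<forall>k\<in>{1..M}. \<forall>r\<in>{1..M}. 0 \<le> P0 M (pmf \<pi>) k r"
  shows "stochastic_matrix {1..M} (P0 M (pmf \<pi>)) \<and>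
         ergodic_matrix {1..M} (P0 M (pmf \<pi>)) \<and>
         stationary_distribution {1..M} (P0 M (pmf \<pi>)) (pmf \<pi>) \<and>
         (\<forall>(N :: 'w measure) X.
            markov_chain N {1..M} (pmf (return_pmf 1)) (P0 M (pmf \<pi>)) X \<longrightarrow>
            (\<exists>T. fastest_strong_stationary_time N {1..M} (pmf (return_pmf 1))
                   (P0 M (pmf \<pi>)) (pmf \<pi>) X T \<and>
                 \<P>(\<omega> in N. T \<omega> = M - 1) = 1))"
proof -
  interpret positive_distribution M "pmf \<pi>"
  proof
    show "1 \<le> M" using set_pmf_not_empty[of \<pi>] assms(1) by (cases M) auto
    show "0 < pmf \<pi> k" if "k \<in> {1..M}" for k
      using that assms(1) by (simp add: pmf_positive)
    show "pmf \<pi> k = 0" if "M < k" for k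
      using that assms(1) by (simp add: pmf_eq_0_set_pmf)
    show "(\<Sum>k=1..M. pmf \<pi> k) = 1"
      using assms(1) by (intro sum_pmf_eq_1) auto
  qed
  have "\<exists>T. fastest_strong_stationary_time N {1..M} (pmf (return_pmf 1))
                   (P0 M (pmf \<pi>)) (pmf \<pi>) X T \<and> \<P>(\<omega> in N. T \<omega> = M - 1) = 1"
    if "markov_chain N {1..M} (pmf (return_pmf 1)) (P0 M (pmf \<pi>)) X"
    for N :: "'w measure" and X
  proof -
    interpret prob_space N using that by (simp add: markov_chain_def)
    show ?thesis
      using P0_fastest_strong_stationary_time[OF that] prob_space
      by (intro exI[of _ "\<lambda>_. M - 1"]) simp
  qed
  then show ?thesis
    using assms(2) P0_row_sum P0_ergodic[OF assms(2)] P0_stationary p_sum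
    by (auto simp: stochastic_matrix_def stationary_distribution_def)
qed

end
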